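(* Let $A$ and $B$ be separably equivalent rings. Then there exists a biseparable bimodule ${}_AV_B$.
   Context: Rings are associative and unital, and modules are unital. A bimodule is left and right finite projective if it is finitely generated projective as a left module and as a right module. Separable equivalence: rings $A$ and $B$ are separably equivalent if there are left and right finite projective bimodules ${}_AP_B$ and ${}_BQ_A$, a split epimorphism of $A$-$A$-bimodules $\nu: P\otimes_B Q\to A$, and a split epimorphism of $B$-$B$-bimodules $\mu: Q\otimes_A P\to B$. Biseparable bimodule: a left and right finite projective bimodule ${}_AV_B$ such that the evaluation maps $V\otimes_B\mathrm{Hom}({}_AV,{}_AA)\to A$ and $\mathrm{Hom}(V_B,B_B)\otimes_A V\to B$ are split epimorphisms of $A$-$A$-bimodules and of $B$-$B$-bimodules, respectively. *)

theory Defs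
  imports "HOL-Algebra.Module" "HOL-Algebra.Free_Abelian_Groups"
begin

text \<open>
  The locale \<^locale>\<open>module\<close> requires a commutative ring, hence the separate notions of left modules,
  right modules and bimodules over arbitrary rings. As for \<^locale>\<open>module\<close>, the fields mult and one
  that the records inherit from rings carry no meaning.
\<close>

record ('a, 'b, 'm) bimodule = "('a, 'm) module" +
  rsmult :: "['m, 'b] \<Rightarrow> 'm" (infixl \<open>\<bullet>\<index>\<close> 70)

locale left_module = R?: ring R + M?: abelian_group M
  for R :: "('a, 'r) ring_scheme" (structure) and M :: "('a, 'm, 'x) module_scheme" (structure) +
  assumes smult_closed:
      "\<lbrakk>a \<in> carrier R; x \<in> carrier M\<rbrakk> \<Longrightarrow> a \<odot>\<^bsub>M\<^esub> x \<in> carrier M"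
    and smult_l_distr:
      "\<lbrakk>a \<in> carrier R; b \<in> carrier R; x \<in> carrier M\<rbrakk>
        \<Longrightarrow> (a \<oplus>\<^bsub>R\<^esub> b) \<odot>\<^bsub>M\<^esub> x = a \<odot>\<^bsub>M\<^esub> x \<oplus>\<^bsub>M\<^esub> b \<odot>\<^bsub>M\<^esub> x"
    and smult_r_distr:
      "\<lbrakk>a \<in> carrier R; x \<in> carrier M; y \<in> carrier M\<rbrakk>
        \<Longrightarrow> a \<odot>\<^bsub>M\<^esub> (x \<oplus>\<^bsub>M\<^esub> y) = a \<odot>\<^bsub>M\<^esub> x \<oplus>\<^bsub>M\<^esub> a \<odot>\<^bsub>M\<^esub> y"
    and smult_assoc:
      "\<lbrakk>a \<in> carrier R; b \<in> carrier R; x \<in> carrier M\<rbrakk>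
        \<Longrightarrow> (a \<otimes>\<^bsub>R\<^esub> b) \<odot>\<^bsub>M\<^esub> x = a \<odot>\<^bsub>M\<^esub> (b \<odot>\<^bsub>M\<^esub> x)"
    and smult_one: "x \<in> carrier M \<Longrightarrow> \<one>\<^bsub>R\<^esub> \<odot>\<^bsub>M\<^esub> x = x"

locale right_module = S?: ring S + M?: abelian_group M
  for S :: "('b, 's) ring_scheme" (structure) and M :: "('a, 'b, 'm, 'x) bimodule_scheme" (structure) +
  assumes rsmult_closed:
      "\<lbrakk>x \<in> carrier M; b \<in> carrier S\<rbrakk> \<Longrightarrow> x \<bullet>\<^bsub>M\<^esub> b \<in> carrier M"
    and rsmult_r_distr:
      "\<lbrakk>x \<in> carrier M; b \<in> carrier S; c \<in> carrier S\<rbrakk>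
        \<Longrightarrow> x \<bullet>\<^bsub>M\<^esub> (b \<oplus>\<^bsub>S\<^esub> c) = x \<bullet>\<^bsub>M\<^esub> b \<oplus>\<^bsub>M\<^esub> x \<bullet>\<^bsub>M\<^esub> c"
    and rsmult_l_distr:
      "\<lbrakk>x \<in> carrier M; y \<in> carrier M; b \<in> carrier S\<rbrakk>
        \<Longrightarrow> (x \<oplus>\<^bsub>M\<^esub> y) \<bullet>\<^bsub>M\<^esub> b = x \<bullet>\<^bsub>M\<^esub> b \<oplus>\<^bsub>M\<^esub> y \<bullet>\<^bsub>M\<^esub> b"
    and rsmult_assoc:
      "\<lbrakk>x \<in> carrier M; b \<in> carrier S; c \<in> carrier S\<rbrakk>
        \<Longrightarrow> x \<bullet>\<^bsub>M\<^esub> (b \<otimes>\<^bsub>S\<^esub> c) = (x \<bullet>\<^bsub>M\<^esub> b) \<bullet>\<^bsub>M\<^esub> c"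
    and rsmult_one: "x \<in> carrier M \<Longrightarrow> x \<bullet>\<^bsub>M\<^esub> \<one>\<^bsub>S\<^esub> = x"

locale bimodule = left_module R M + right_module S M
  for R :: "('a, 'r) ring_scheme" (structure) and S :: "('b, 's) ring_scheme" (structure)
    and M :: "('a, 'b, 'm, 'x) bimodule_scheme" (structure) +
  assumes smult_rsmult:
      "\<lbrakk>a \<in> carrier R; x \<in> carrier M; b \<in> carrier S\<rbrakk>
        \<Longrightarrow> (a \<odot>\<^bsub>M\<^esub> x) \<bullet>\<^bsub>M\<^esub> b = a \<odot>\<^bsub>M\<^esub> (x \<bullet>\<^bsub>M\<^esub> b)"

definition left_hom ::
  "('a, 'r) ring_scheme \<Rightarrow> ('a, 'm, 'x) module_scheme \<Rightarrow> ('a, 'n, 'y) module_scheme \<Rightarrow> ('m \<Rightarrow> 'n) set"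
  where "left_hom R M N = {h \<in> carrier M \<rightarrow> carrier N.
    (\<forall>x\<in>carrier M. \<forall>y\<in>carrier M. h (x \<oplus>\<^bsub>M\<^esub> y) = h x \<oplus>\<^bsub>N\<^esub> h y) \<and>
    (\<forall>a\<in>carrier R. \<forall>x\<in>carrier M. h (a \<odot>\<^bsub>M\<^esub> x) = a \<odot>\<^bsub>N\<^esub> h x)}"

definition right_hom ::
  "('b, 's) ring_scheme \<Rightarrow> ('a, 'b, 'm, 'x) bimodule_scheme \<Rightarrow> ('c, 'b, 'n, 'y) bimodule_scheme
    \<Rightarrow> ('m \<Rightarrow> 'n) set"
  where "right_hom S M N = {h \<in> carrier M \<rightarrow> carrier N.
    (\<forall>x\<in>carrier M. \<forall>y\<in>carrier M. h (x \<oplus>\<^bsub>M\<^esub> y) = h x \<oplus>\<^bsub>N\<^esub> h y) \<and>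
    (\<forall>x\<in>carrier M. \<forall>b\<in>carrier S. h (x \<bullet>\<^bsub>M\<^esub> b) = h x \<bullet>\<^bsub>N\<^esub> b)}"

definition bimodule_hom ::
  "('a, 'r) ring_scheme \<Rightarrow> ('b, 's) ring_scheme \<Rightarrow> ('a, 'b, 'm, 'x) bimodule_scheme
    \<Rightarrow> ('a, 'b, 'n, 'y) bimodule_scheme \<Rightarrow> ('m \<Rightarrow> 'n) set"
  where "bimodule_hom R S M N = left_hom R M N \<inter> right_hom S M N"

definition split_bimodule_epi ::
  "('a, 'r) ring_scheme \<Rightarrow> ('b, 's) ring_scheme \<Rightarrow> ('a, 'b, 'm, 'x) bimodule_scheme
    \<Rightarrow> ('a, 'b, 'n, 'y) bimodule_scheme \<Rightarrow> ('m \<Rightarrow> 'n) \<Rightarrow> bool"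
  where "split_bimodule_epi R S M N f \<longleftrightarrow> f \<in> bimodule_hom R S M N \<and>
    (\<exists>g\<in>bimodule_hom R S N M. \<forall>y\<in>carrier N. f (g y) = y)"

definition regular_bimodule :: "('a, 'r) ring_scheme \<Rightarrow> ('a, 'a, 'a) bimodule"
  where "regular_bimodule R = \<lparr>carrier = carrier R, mult = mult R, one = \<one>\<^bsub>R\<^esub>,
    ring.zero = \<zero>\<^bsub>R\<^esub>, add = add R, smult = mult R, rsmult = mult R\<rparr>"

text \<open>
  The direct sum of copies of \<open>R\<close> indexed by \<open>X\<close>, with both of its actions: it is the free left
  and the free right \<open>R\<close>-module with basis \<open>X\<close>.
\<close>

definition free_bimodule :: "('a, 'r) ring_scheme \<Rightarrow> 'i set \<Rightarrow> ('a, 'a, 'i \<Rightarrow> 'a) bimodule"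
  where "free_bimodule R X =
    \<lparr>carrier = {f \<in> X \<rightarrow>\<^sub>E carrier R. finite {i \<in> X. f i \<noteq> \<zero>\<^bsub>R\<^esub>}},
     mult = undefined, one = undefined,
     ring.zero = (\<lambda>i\<in>X. \<zero>\<^bsub>R\<^esub>), add = (\<lambda>f g. \<lambda>i\<in>X. f i \<oplus>\<^bsub>R\<^esub> g i),
     smult = (\<lambda>a f. \<lambda>i\<in>X. a \<otimes>\<^bsub>R\<^esub> f i), rsmult = (\<lambda>f a. \<lambda>i\<in>X. f i \<otimes>\<^bsub>R\<^esub> a)\<rparr>"

text \<open>
  Projective modules are the direct summands of free modules. Basis sets in the type of the
  elements of \<open>M\<close> suffice: a direct summand \<open>M\<close> of any free module is a direct
  summand of the free module with basis the carrier of \<open>M\<close>, which maps onto \<open>M\<close>.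
\<close>

definition left_projective :: "('a, 'r) ring_scheme \<Rightarrow> ('a, 'm, 'x) module_scheme \<Rightarrow> bool"
  where "left_projective R M \<longleftrightarrow> (\<exists>X :: 'm set.
    \<exists>i\<in>left_hom R M (free_bimodule R X). \<exists>p\<in>left_hom R (free_bimodule R X) M.
      \<forall>x\<in>carrier M. p (i x) = x)"

definition right_projective :: "('b, 's) ring_scheme \<Rightarrow> ('a, 'b, 'm, 'x) bimodule_scheme \<Rightarrow> bool"
  where "right_projective S M \<longleftrightarrow> (\<exists>X :: 'm set.
    \<exists>i\<in>right_hom S M (free_bimodule S X). \<exists>p\<in>right_hom S (free_bimodule S X) M.
      \<forall>x\<in>carrier M. p (i x) = x)"

definition left_fin_gen :: "('a, 'r) ring_scheme \<Rightarrow> ('a, 'm, 'x) module_scheme \<Rightarrow> bool"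
  where "left_fin_gen R M \<longleftrightarrow> (\<exists>X. finite X \<and> X \<subseteq> carrier M \<and>
    (\<forall>x\<in>carrier M. \<exists>c\<in>X \<rightarrow> carrier R. x = (\<Oplus>\<^bsub>M\<^esub>y\<in>X. c y \<odot>\<^bsub>M\<^esub> y)))"

definition right_fin_gen :: "('b, 's) ring_scheme \<Rightarrow> ('a, 'b, 'm, 'x) bimodule_scheme \<Rightarrow> bool"
  where "right_fin_gen S M \<longleftrightarrow> (\<exists>X. finite X \<and> X \<subseteq> carrier M \<and>
    (\<forall>x\<in>carrier M. \<exists>c\<in>X \<rightarrow> carrier S. x = (\<Oplus>\<^bsub>M\<^esub>y\<in>X. y \<bullet>\<^bsub>M\<^esub> c y)))"

definition fin_proj_bimodule ::
  "('a, 'r) ring_scheme \<Rightarrow> ('b, 's) ring_scheme \<Rightarrow> ('a, 'b, 'm, 'x) bimodule_scheme \<Rightarrow> bool"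
  where "fin_proj_bimodule R S M \<longleftrightarrow> bimodule R S M \<and>
    left_fin_gen R M \<and> left_projective R M \<and> right_fin_gen S M \<and> right_projective S M"

text \<open>
  The tensor product over \<open>S\<close> is the quotient of the free abelian group on the pairs by the
  subgroup generated by the following elements; its elements are cosets.
\<close>

definition tensor_relations ::
  "('b, 's) ring_scheme \<Rightarrow> ('a, 'b, 'm, 'x) bimodule_scheme \<Rightarrow> ('b, 'c, 'n, 'y) bimodule_scheme
    \<Rightarrow> ('m \<times> 'n \<Rightarrow>\<^sub>0 int) set"
  where "tensor_relations S M N =
    {frag_of (x \<oplus>\<^bsub>M\<^esub> x', y) - (frag_of (x, y) + frag_of (x', y)) | x x' y.
       x \<in> carrier M \<and> x' \<in> carrier M \<and> y \<in> carrier N} \<union>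
    {frag_of (x, y \<oplus>\<^bsub>N\<^esub> y') - (frag_of (x, y) + frag_of (x, y')) | x y y'.
       x \<in> carrier M \<and> y \<in> carrier N \<and> y' \<in> carrier N} \<union>
    {frag_of (x \<bullet>\<^bsub>M\<^esub> b, y) - frag_of (x, b \<odot>\<^bsub>N\<^esub> y) | x b y.
       x \<in> carrier M \<and> b \<in> carrier S \<and> y \<in> carrier N}"

definition tensor_subgroup ::
  "('b, 's) ring_scheme \<Rightarrow> ('a, 'b, 'm, 'x) bimodule_scheme \<Rightarrow> ('b, 'c, 'n, 'y) bimodule_scheme
    \<Rightarrow> ('m \<times> 'n \<Rightarrow>\<^sub>0 int) set"
  where "tensor_subgroup S M N =
    generate (free_Abelian_group (carrier M \<times> carrier N)) (tensor_relations S M N)"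

text \<open>
  The actions are induced by acting on the basis pairs; adding the subgroup to the image of a coset
  yields the full coset again.
\<close>

definition tensor_product ::
  "('b, 's) ring_scheme \<Rightarrow> ('a, 'b, 'm, 'x) bimodule_scheme \<Rightarrow> ('b, 'c, 'n, 'y) bimodule_scheme
    \<Rightarrow> ('a, 'c, ('m \<times> 'n \<Rightarrow>\<^sub>0 int) set) bimodule"
  where "tensor_product S M N =
    (let F = free_Abelian_group (carrier M \<times> carrier N); K = tensor_subgroup S M N in
     \<lparr>carrier = carrier (F Mod K), mult = undefined, one = undefined,
      ring.zero = \<one>\<^bsub>F Mod K\<^esub>, add = mult (F Mod K),
      smult = (\<lambda>a C. K <#>\<^bsub>F\<^esub> (frag_extend (\<lambda>(x, y). frag_of (a \<odot>\<^bsub>M\<^esub> x, y)) ` C)),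
      rsmult = (\<lambda>C c. K <#>\<^bsub>F\<^esub> (frag_extend (\<lambda>(x, y). frag_of (x, y \<bullet>\<^bsub>N\<^esub> c)) ` C))\<rparr>)"

text \<open>
  The map from a tensor product to \<open>T\<close> sending \<open>x \<otimes> y\<close> to \<open>h x y\<close>, for a
  biadditive and balanced \<open>h\<close>: the additive extension of \<open>h\<close> to the free abelian
  group is then constant on each coset.
\<close>

definition tensor_lift ::
  "('t, 'z) ring_scheme \<Rightarrow> ('m \<Rightarrow> 'n \<Rightarrow> 't) \<Rightarrow> ('m \<times> 'n \<Rightarrow>\<^sub>0 int) set \<Rightarrow> 't"
  where "tensor_lift T h C = the_elem
    ((\<lambda>c. \<Oplus>\<^bsub>T\<^esub>z\<in>Poly_Mapping.keys c. [Poly_Mapping.lookup c z] \<cdot>\<^bsub>T\<^esub> h (fst z) (snd z)) ` C)"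

text \<open>
  For an \<open>A\<close>-\<open>B\<close>-bimodule \<open>V\<close>, both duals are \<open>B\<close>-\<open>A\<close>-bimodules:
  \<open>(b f a)(v) = f(v b) a\<close> for left \<open>A\<close>-linear \<open>f\<close> from \<open>V\<close> to \<open>A\<close>, and
  \<open>(b g a)(v) = b g(a v)\<close> for right \<open>B\<close>-linear \<open>g\<close> from \<open>V\<close> to \<open>B\<close>.
\<close>

definition left_dual ::
  "('a, 'r) ring_scheme \<Rightarrow> ('a, 'b, 'm, 'x) bimodule_scheme \<Rightarrow> ('b, 'a, 'm \<Rightarrow> 'a) bimodule"
  where "left_dual A V =
    \<lparr>carrier = left_hom A V (regular_bimodule A) \<inter> extensional (carrier V),
     mult = undefined, one = undefined,
     ring.zero = (\<lambda>v\<in>carrier V. \<zero>\<^bsub>A\<^esub>), add = (\<lambda>f g. \<lambda>v\<in>carrier V. f v \<oplus>\<^bsub>A\<^esub> g v),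
     smult = (\<lambda>b f. \<lambda>v\<in>carrier V. f (v \<bullet>\<^bsub>V\<^esub> b)),
     rsmult = (\<lambda>f a. \<lambda>v\<in>carrier V. f v \<otimes>\<^bsub>A\<^esub> a)\<rparr>"

definition right_dual ::
  "('b, 's) ring_scheme \<Rightarrow> ('a, 'b, 'm, 'x) bimodule_scheme \<Rightarrow> ('b, 'a, 'm \<Rightarrow> 'b) bimodule"
  where "right_dual B V =
    \<lparr>carrier = right_hom B V (regular_bimodule B) \<inter> extensional (carrier V),
     mult = undefined, one = undefined,
     ring.zero = (\<lambda>v\<in>carrier V. \<zero>\<^bsub>B\<^esub>), add = (\<lambda>f g. \<lambda>v\<in>carrier V. f v \<oplus>\<^bsub>B\<^esub> g v),
     smult = (\<lambda>b g. \<lambda>v\<in>carrier V. b \<otimes>\<^bsub>B\<^esub> g v),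
     rsmult = (\<lambda>g a. \<lambda>v\<in>carrier V. g (a \<odot>\<^bsub>V\<^esub> v))\<rparr>"

text \<open>
  The types \<open>'p\<close> and \<open>'q\<close> of the elements of the two bimodules are parameters, because HOL does
  not quantify over types inside a formula.
\<close>

definition separably_equivalent ::
  "'p itself \<Rightarrow> 'q itself \<Rightarrow> ('a, 'r) ring_scheme \<Rightarrow> ('b, 's) ring_scheme \<Rightarrow> bool"
  where "separably_equivalent _ _ A B \<longleftrightarrow>
    (\<exists>(P :: ('a, 'b, 'p) bimodule) (Q :: ('b, 'a, 'q) bimodule).
       fin_proj_bimodule A B P \<and> fin_proj_bimodule B A Q \<and>
       (\<exists>\<nu>. split_bimodule_epi A A (tensor_product B P Q) (regular_bimodule A) \<nu>) \<and>
       (\<exists>\<mu>. split_bimodule_epi B B (tensor_product A Q P) (regular_bimodule B) \<mu>))"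

definition biseparable ::
  "('a, 'r) ring_scheme \<Rightarrow> ('b, 's) ring_scheme \<Rightarrow> ('a, 'b, 'm, 'x) bimodule_scheme \<Rightarrow> bool"
  where "biseparable A B V \<longleftrightarrow> fin_proj_bimodule A B V \<and>
    split_bimodule_epi A A (tensor_product B V (left_dual A V)) (regular_bimodule A)
      (tensor_lift A (\<lambda>v f. f v)) \<and>
    split_bimodule_epi B B (tensor_product A (right_dual B V) V) (regular_bimodule B)
      (tensor_lift B (\<lambda>g v. g v))"

end

theory Submission
  imports Defs
begin

text \<open>
  The left-hand bimodule \<open>P\<close> of a separable equivalence is itself biseparable. Let
  \<open>\<nu>: P \<otimes> Q \<rightarrow> A\<close> be a split bimodule epimorphism with section \<open>s\<close>. Through \<open>\<nu>\<close> every element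
  of \<open>Q\<close> acts as a left \<open>A\<close>-linear functional on \<open>P\<close>: the rule \<open>q \<mapsto> \<nu>(- \<otimes> q)\<close> is a bimodule
  homomorphism \<open>\<phi>\<close> from \<open>Q\<close> to the left dual of \<open>P\<close>. Evaluation after \<open>1 \<otimes> \<phi>\<close> sends
  \<open>p \<otimes> q\<close> to \<open>\<phi>(q)(p) = \<nu>(p \<otimes> q)\<close>, so that it equals \<open>\<nu>\<close>, and \<open>(1 \<otimes> \<phi>) \<circ> s\<close> is a section of
  the evaluation map. Likewise \<open>\<mu>: Q \<otimes> P \<rightarrow> B\<close> yields a bimodule homomorphism
  \<open>q \<mapsto> \<mu>(q \<otimes> -)\<close> from \<open>Q\<close> to the right dual of \<open>P\<close>, through which \<open>\<mu>\<close> factors.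

  Both halves are instances of one statement, \<open>split_epi_tensor_lift\<close>: for bimodules \<open>M\<close>, \<open>N\<close>
  with a balanced pairing \<open>\<beta>\<close> into the base ring, the induced map on \<open>M \<otimes> N\<close> is a split
  epimorphism as soon as some split epimorphism on a tensor product
  \<open>M\<^sub>0 \<otimes> N\<^sub>0\<close> factors through it by way of homomorphisms \<open>M\<^sub>0 \<rightarrow> M\<close> and \<open>N\<^sub>0 \<rightarrow> N\<close>. It rests on the
  functoriality of the tensor product (\<open>tensor_map_bimodule_hom\<close>) and on its universal property
  (\<open>tensor_lift_hom\<close>, \<open>tensor_lift_pure\<close>). Elements of tensor products are cosets in a free
  abelian group; identities between maps on tensor products are therefore checked on
  representatives, and by additivity on basis elements alone
  (\<open>hom_free_Abelian_group_cong\<close>).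
\<close>

section \<open>Additive maps on free abelian groups\<close>

lemma hom_free_Abelian_group_cong:
  assumes G: "group G"
    and h: "h \<in> hom (free_Abelian_group S) G" and k: "k \<in> hom (free_Abelian_group S) G"
    and eq: "\<And>x. x \<in> S \<Longrightarrow> h (frag_of x) = k (frag_of x)"
    and c: "Poly_Mapping.keys c \<subseteq> S"
  shows "h c = k c"
proof -
  interpret h: group_hom "free_Abelian_group S" G h
    using G h by (simp add: group_hom_def group_hom_axioms_def)
  interpret k: group_hom "free_Abelian_group S" G k
    using G k by (simp add: group_hom_def group_hom_axioms_def)
  have diff: "f (x - y) = f x \<otimes>\<^bsub>G\<^esub> inv\<^bsub>G\<^esub> f y"
    if "group_hom (free_Abelian_group S) G f" "Poly_Mapping.keys x \<subseteq> S" "Poly_Mapping.keys y \<subseteq> S"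
    for f x y
  proof -
    interpret f: group_hom "free_Abelian_group S" G f by fact
    show ?thesis
      using f.hom_mult[of x "- y"] f.hom_inv[of y] that(2,3) by (simp add: keys_minus)
  qed
  show ?thesis
  proof (rule free_Abelian_group_induct[of c S "\<lambda>c. h c = k c"])
    show "h 0 = k 0"
      using h.hom_one k.hom_one by simp
    show "h (x - y) = k (x - y)"
      if "Poly_Mapping.keys x \<subseteq> S" "Poly_Mapping.keys y \<subseteq> S" "h x = k x" "h y = k y" for x y
      using that by (simp add: diff[OF h.group_hom_axioms] diff[OF k.group_hom_axioms])
  qed (use c eq in auto)
qed

text \<open>
  The extension of \<open>f\<close> in the universal property of free abelian groups, in the explicit form of
  the sum over the support that occurs in the definition of \<^const>\<open>tensor_lift\<close>.
\<close>

lemma (in comm_group) free_Abelian_group_extension_hom: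
  assumes f: "f \<in> S \<rightarrow> carrier G"
  defines "L \<equiv> \<lambda>c. \<Otimes>z\<in>Poly_Mapping.keys c. f z [^] Poly_Mapping.lookup c z"
  shows "L \<in> hom (free_Abelian_group S) G"
    and "x \<in> S \<Longrightarrow> L (frag_of x) = f x"
proof -
  \<comment> \<open>The sum may be taken over any finite set that contains the support, which makes
    the sums for two elements comparable.\<close>
  have L: "L c = (\<Otimes>z\<in>I. f z [^] Poly_Mapping.lookup c z)"
    if "finite I" "Poly_Mapping.keys c \<subseteq> I" "I \<subseteq> S" for c I
    unfolding L_def
    by (rule finprod_mono_neutral_cong_left) (use that f in \<open>auto simp: in_keys_iff\<close>)
  show "L \<in> hom (free_Abelian_group S) G"
  proof (rule homI)
    fix c d assume "c \<in> carrier (free_Abelian_group S)" "d \<in> carrier (free_Abelian_group S)"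
    then have cd: "Poly_Mapping.keys c \<subseteq> S" "Poly_Mapping.keys d \<subseteq> S" by auto
    let ?I = "Poly_Mapping.keys c \<union> Poly_Mapping.keys d"
    have fI: "f z \<in> carrier G" if "z \<in> ?I" for z
      using f cd that by auto
    have "L (c + d) = (\<Otimes>z\<in>?I. f z [^] Poly_Mapping.lookup (c + d) z)"
      by (rule L) (use cd keys_add[of c d] in auto)
    also have "\<dots> = (\<Otimes>z\<in>?I. f z [^] Poly_Mapping.lookup c z \<otimes> f z [^] Poly_Mapping.lookup d z)"
      by (rule finprod_cong') (auto simp: fI lookup_add int_pow_mult)
    also have "\<dots> = L c \<otimes> L d"
      using cd by (subst (1 2) L[of ?I]) (auto simp: fI intro!: finprod_multf)
    finally show "L (c \<otimes>\<^bsub>free_Abelian_group S\<^esub> d) = L c \<otimes> L d" by simp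
  qed (use f in \<open>auto simp: L_def Pi_iff intro!: finprod_closed\<close>)
  show "L (frag_of x) = f x" if "x \<in> S"
    using that f by (simp add: L_def Pi_iff)
qed

lemma frag_extend_in_hom:
  assumes "\<And>x. x \<in> S \<Longrightarrow> \<phi> x \<in> T"
  shows "frag_extend (\<lambda>x. frag_of (\<phi> x)) \<in> hom (free_Abelian_group S) (free_Abelian_group T)"
proof (rule homI)
  fix c assume "c \<in> carrier (free_Abelian_group S)"
  then show "frag_extend (\<lambda>x. frag_of (\<phi> x)) c \<in> carrier (free_Abelian_group T)"
    using keys_frag_extend[of "\<lambda>x. frag_of (\<phi> x)" c] assms by fastforce
qed (simp add: frag_extend_add)

section \<open>Tensor products as quotients\<close>

definition tensor_class ::
  "('b, 's) ring_scheme \<Rightarrow> ('a, 'b, 'm, 'x) bimodule_scheme \<Rightarrow> ('b, 'c, 'n, 'y) bimodule_scheme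
    \<Rightarrow> ('m \<times> 'n \<Rightarrow>\<^sub>0 int) \<Rightarrow> ('m \<times> 'n \<Rightarrow>\<^sub>0 int) set"
  where "tensor_class S M N c =
    tensor_subgroup S M N #>\<^bsub>free_Abelian_group (carrier M \<times> carrier N)\<^esub> c"

lemma tensor_relations_I:
  shows "\<lbrakk>x \<in> carrier M; x' \<in> carrier M; y \<in> carrier N\<rbrakk> \<Longrightarrow>
      frag_of (x \<oplus>\<^bsub>M\<^esub> x', y) - (frag_of (x, y) + frag_of (x', y)) \<in> tensor_relations S M N"
    and "\<lbrakk>x \<in> carrier M; y \<in> carrier N; y' \<in> carrier N\<rbrakk> \<Longrightarrow>
      frag_of (x, y \<oplus>\<^bsub>N\<^esub> y') - (frag_of (x, y) + frag_of (x, y')) \<in> tensor_relations S M N"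
    and "\<lbrakk>x \<in> carrier M; b \<in> carrier S; y \<in> carrier N\<rbrakk> \<Longrightarrow>
      frag_of (x \<bullet>\<^bsub>M\<^esub> b, y) - frag_of (x, b \<odot>\<^bsub>N\<^esub> y) \<in> tensor_relations S M N"
  unfolding tensor_relations_def Un_iff mem_Collect_eq by metis+

lemma image_tensor_relations_subset:
  assumes "\<And>x x' y. \<lbrakk>x \<in> carrier M; x' \<in> carrier M; y \<in> carrier N\<rbrakk> \<Longrightarrow>
      t (frag_of (x \<oplus>\<^bsub>M\<^esub> x', y) - (frag_of (x, y) + frag_of (x', y))) \<in> H"
    and "\<And>x y y'. \<lbrakk>x \<in> carrier M; y \<in> carrier N; y' \<in> carrier N\<rbrakk> \<Longrightarrow>
      t (frag_of (x, y \<oplus>\<^bsub>N\<^esub> y') - (frag_of (x, y) + frag_of (x, y'))) \<in> H"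
    and "\<And>x b y. \<lbrakk>x \<in> carrier M; b \<in> carrier S; y \<in> carrier N\<rbrakk> \<Longrightarrow>
      t (frag_of (x \<bullet>\<^bsub>M\<^esub> b, y) - frag_of (x, b \<odot>\<^bsub>N\<^esub> y)) \<in> H"
  shows "t ` tensor_relations S M N \<subseteq> H"
proof (rule image_subsetI)
  fix c assume "c \<in> tensor_relations S M N"
  then show "t c \<in> H"
    unfolding tensor_relations_def
    by (elim UnE CollectE exE conjE) (simp_all only: assms)
qed

locale tensor_pair = L: bimodule R S M + N: bimodule S T N
  for R :: "('a, 'r) ring_scheme" and S :: "('b, 's) ring_scheme" and T :: "('c, 't) ring_scheme"
    and M :: "('a, 'b, 'm, 'x) bimodule_scheme" and N :: "('b, 'c, 'n, 'y) bimodule_scheme"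
begin

abbreviation "pairs \<equiv> carrier M \<times> carrier N"
abbreviation "F \<equiv> free_Abelian_group pairs"
abbreviation "K \<equiv> tensor_subgroup S M N"
abbreviation "tclass \<equiv> tensor_class S M N"
abbreviation "pure x y \<equiv> tensor_class S M N (frag_of (x, y))"

lemma tensor_relations_subset: "tensor_relations S M N \<subseteq> carrier F"
proof -
  have "Poly_Mapping.keys (c - d) \<subseteq> pairs"
    if "Poly_Mapping.keys c \<subseteq> pairs" "Poly_Mapping.keys d \<subseteq> pairs" for c d :: "'m \<times> 'n \<Rightarrow>\<^sub>0 int"
    using keys_diff[of c d] that by blast
  moreover have "Poly_Mapping.keys (c + d) \<subseteq> pairs"
    if "Poly_Mapping.keys c \<subseteq> pairs" "Poly_Mapping.keys d \<subseteq> pairs" for c d :: "'m \<times> 'n \<Rightarrow>\<^sub>0 int"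
    using keys_add[of c d] that by blast
  ultimately show ?thesis
    unfolding tensor_relations_def
    by (intro Un_least subsetI; elim CollectE exE conjE; simp only: carrier_free_Abelian_group_iff)
      (simp_all add: L.rsmult_closed N.smult_closed)
qed

lemma tensor_subgroup_subgroup: "subgroup K F"
  unfolding tensor_subgroup_def
  by (intro group.generate_is_subgroup group_free_Abelian_group tensor_relations_subset)

lemma tensor_subgroup_normal: "K \<lhd> F"
  by (intro comm_group.subgroup_imp_normal abelian_free_Abelian_group tensor_subgroup_subgroup)

text \<open>
  To map the subgroup of relations into a given subgroup, it suffices to do so for the generating
  relations. With \<open>H\<close> another subgroup of relations this shows that maps of tensor products are
  well defined, with \<open>H\<close> trivial it shows that maps out of a tensor product are.
\<close>

lemma hom_tensor_subgroup:
  assumes G: "group G" and H: "subgroup H G" and h: "h \<in> hom F G"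
    and rel: "h ` tensor_relations S M N \<subseteq> H"
  shows "h ` K \<subseteq> H"
proof -
  interpret h: group_hom F G h
    using G h by (simp add: group_hom_def group_hom_axioms_def)
  show ?thesis
    unfolding tensor_subgroup_def h.generate_img[OF tensor_relations_subset, symmetric]
    by (rule group.generate_subgroup_incl[OF G rel H])
qed

lemma tensor_class_alt: "tclass c = (\<lambda>k. k + c) ` K"
  by (auto simp: tensor_class_def r_coset_def)

lemma carrier_tensor_product:
  "carrier (tensor_product S M N) = tclass ` carrier F"
  by (simp add: tensor_product_def Let_def carrier_FactGroup tensor_class_def)

lemma tensor_class_eqI:
  assumes "c - d \<in> K" "Poly_Mapping.keys d \<subseteq> pairs"
  shows "tclass c = tclass d"
proof -
  have "c \<in> K #>\<^bsub>F\<^esub> d"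
    using assms(1) by (force simp: r_coset_def)
  then show ?thesis
    unfolding tensor_class_def
    using group.repr_independence[OF group_free_Abelian_group _ _ tensor_subgroup_subgroup] assms(2)
    by fastforce
qed

lemma add_tensor_class:
  assumes "Poly_Mapping.keys c \<subseteq> pairs" "Poly_Mapping.keys d \<subseteq> pairs"
  shows "tclass c \<oplus>\<^bsub>tensor_product S M N\<^esub> tclass d = tclass (c + d)"
  using normal.rcos_sum[OF tensor_subgroup_normal, of c d] assms
  by (simp add: tensor_product_def Let_def tensor_class_def)

lemma tensor_class_in_carrier:
  "Poly_Mapping.keys c \<subseteq> pairs \<Longrightarrow> tclass c \<in> carrier (tensor_product S M N)"
  by (auto simp: carrier_tensor_product)

lemma tensor_class_eq_of_relation:
  assumes "c - d \<in> tensor_relations S M N" "Poly_Mapping.keys d \<subseteq> pairs"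
  shows "tclass c = tclass d"
  by (rule tensor_class_eqI) (use assms in \<open>auto simp: tensor_subgroup_def intro: generate.incl\<close>)

lemma pure_add_left:
  assumes "x \<in> carrier M" "x' \<in> carrier M" "y \<in> carrier N"
  shows "pure (x \<oplus>\<^bsub>M\<^esub> x') y = pure x y \<oplus>\<^bsub>tensor_product S M N\<^esub> pure x' y"
proof -
  have "pure (x \<oplus>\<^bsub>M\<^esub> x') y = tclass (frag_of (x, y) + frag_of (x', y))"
  proof (rule tensor_class_eq_of_relation)
    show "frag_of (x \<oplus>\<^bsub>M\<^esub> x', y) - (frag_of (x, y) + frag_of (x', y)) \<in> tensor_relations S M N"
      by (intro tensor_relations_I assms)
  qed (use assms keys_add[of "frag_of (x, y)" "frag_of (x', y)"] in auto)
  then show ?thesis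
    using assms by (simp add: add_tensor_class)
qed

lemma pure_add_right:
  assumes "x \<in> carrier M" "y \<in> carrier N" "y' \<in> carrier N"
  shows "pure x (y \<oplus>\<^bsub>N\<^esub> y') = pure x y \<oplus>\<^bsub>tensor_product S M N\<^esub> pure x y'"
proof -
  have "pure x (y \<oplus>\<^bsub>N\<^esub> y') = tclass (frag_of (x, y) + frag_of (x, y'))"
  proof (rule tensor_class_eq_of_relation)
    show "frag_of (x, y \<oplus>\<^bsub>N\<^esub> y') - (frag_of (x, y) + frag_of (x, y')) \<in> tensor_relations S M N"
      by (intro tensor_relations_I assms)
  qed (use assms keys_add[of "frag_of (x, y)" "frag_of (x, y')"] in auto)
  then show ?thesis
    using assms by (simp add: add_tensor_class)
qed

lemma pure_balanced:
  assumes "x \<in> carrier M" "b \<in> carrier S" "y \<in> carrier N"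
  shows "pure (x \<bullet>\<^bsub>M\<^esub> b) y = pure x (b \<odot>\<^bsub>N\<^esub> y)"
proof (rule tensor_class_eq_of_relation)
  show "frag_of (x \<bullet>\<^bsub>M\<^esub> b, y) - frag_of (x, b \<odot>\<^bsub>N\<^esub> y) \<in> tensor_relations S M N"
    by (intro tensor_relations_I assms)
qed (use assms in \<open>auto simp: N.smult_closed\<close>)

text \<open>
  The actions on a tensor product and the maps between tensor products are both given on a coset
  as the subgroup added to an image of the coset. For an additive map that respects the relations
  this is the coset of the image of any representative.
\<close>

lemma induced_map_tensor_class:
  assumes t: "\<And>c d. t (c + d) = t c + t d" and c: "Poly_Mapping.keys c \<subseteq> pairs"
    and K': "subgroup K' (free_Abelian_group X)" and tK: "t ` K \<subseteq> K'"
  shows "K' <#>\<^bsub>free_Abelian_group X\<^esub> (t ` tclass c) = K' #>\<^bsub>free_Abelian_group X\<^esub> t c"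
proof
  have 0: "0 \<in> K"
    using subgroup.one_closed[OF tensor_subgroup_subgroup] by simp
  show "K' <#>\<^bsub>free_Abelian_group X\<^esub> (t ` tclass c) \<subseteq> K' #>\<^bsub>free_Abelian_group X\<^esub> t c"
    using tK subgroup.m_closed[OF K']
    by (force simp: set_mult_def r_coset_def tensor_class_alt t image_iff simp flip: add.assoc)
  show "K' #>\<^bsub>free_Abelian_group X\<^esub> t c \<subseteq> K' <#>\<^bsub>free_Abelian_group X\<^esub> (t ` tclass c)"
    using 0 by (force simp: set_mult_def r_coset_def tensor_class_alt)
qed

end

section \<open>Functoriality of the tensor product\<close>

definition tensor_frag ::
  "('m \<Rightarrow> 'm2) \<Rightarrow> ('n \<Rightarrow> 'n2) \<Rightarrow> ('m \<times> 'n \<Rightarrow>\<^sub>0 int) \<Rightarrow> ('m2 \<times> 'n2 \<Rightarrow>\<^sub>0 int)"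
  where "tensor_frag f g = frag_extend (\<lambda>(x, y). frag_of (f x, g y))"

lemma tensor_frag_frag_of [simp]: "tensor_frag f g (frag_of (x, y)) = frag_of (f x, g y)"
  by (simp add: tensor_frag_def)

lemma tensor_frag_add: "tensor_frag f g (c + d) = tensor_frag f g c + tensor_frag f g d"
  by (simp add: tensor_frag_def frag_extend_add)

lemma tensor_frag_diff: "tensor_frag f g (c - d) = tensor_frag f g c - tensor_frag f g d"
  by (simp add: tensor_frag_def frag_extend_diff)

lemma tensor_frag_alt: "tensor_frag f g = frag_extend (frag_of \<circ> map_prod f g)"
  by (rule ext) (auto simp: tensor_frag_def intro: frag_extend_eq)

lemma tensor_frag_in_hom:
  assumes "f \<in> A \<rightarrow> A'" "g \<in> B \<rightarrow> B'"
  shows "tensor_frag f g \<in> hom (free_Abelian_group (A \<times> B)) (free_Abelian_group (A' \<times> B'))"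
  unfolding tensor_frag_alt comp_def using assms by (intro frag_extend_in_hom) auto

lemma keys_tensor_frag:
  assumes "f \<in> A \<rightarrow> A'" "g \<in> B \<rightarrow> B'" "Poly_Mapping.keys c \<subseteq> A \<times> B"
  shows "Poly_Mapping.keys (tensor_frag f g c) \<subseteq> A' \<times> B'"
  using hom_in_carrier[OF tensor_frag_in_hom[OF assms(1,2)], of c] assms(3) by simp

lemma tensor_frag_compose:
  "tensor_frag f g (tensor_frag f' g' c) = tensor_frag (\<lambda>x. f (f' x)) (\<lambda>y. g (g' y)) c"
proof -
  have "tensor_frag f g (tensor_frag f' g' c)
      = frag_extend ((frag_of \<circ> map_prod f g) \<circ> map_prod f' g') c"
    unfolding tensor_frag_alt by (rule frag_extend_compose)
  also have "\<dots> = tensor_frag (\<lambda>x. f (f' x)) (\<lambda>y. g (g' y)) c"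
    unfolding tensor_frag_alt by (rule frag_extend_eq) auto
  finally show ?thesis .
qed

lemma tensor_frag_cong:
  assumes "Poly_Mapping.keys c \<subseteq> A \<times> B"
    and "\<And>x. x \<in> A \<Longrightarrow> f x = f' x" "\<And>y. y \<in> B \<Longrightarrow> g y = g' y"
  shows "tensor_frag f g c = tensor_frag f' g' c"
  unfolding tensor_frag_def by (rule frag_extend_eq) (use assms in auto)

text \<open>
  The relations involve the sums and the middle ring \<open>S\<close>, so maps that are additive and
  \<open>S\<close>-linear respect them. Besides pairs of bimodule homomorphisms this covers the outer actions:
  \<open>x \<mapsto> a x\<close> is right linear, but over a noncommutative ring in general not left linear.
\<close>

lemma (in tensor_pair) tensor_frag_tensor_class:
  assumes "tensor_pair R' S T' M' N'"
    and f: "f \<in> right_hom S M M'" and g: "g \<in> left_hom S N N'"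
    and c: "Poly_Mapping.keys c \<subseteq> carrier M \<times> carrier N"
  shows "tensor_subgroup S M' N' <#>\<^bsub>free_Abelian_group (carrier M' \<times> carrier N')\<^esub>
      (tensor_frag f g ` tensor_class S M N c) = tensor_class S M' N' (tensor_frag f g c)"
proof -
  interpret P': tensor_pair R' S T' M' N' by fact
  have t: "tensor_frag f g \<in> hom F P'.F"
    by (rule tensor_frag_in_hom) (use f g in \<open>auto simp: right_hom_def left_hom_def\<close>)
  have "tensor_frag f g ` K \<subseteq> P'.K"
  proof (rule hom_tensor_subgroup[OF group_free_Abelian_group P'.tensor_subgroup_subgroup t])
    have "tensor_frag f g ` tensor_relations S M N \<subseteq> tensor_relations S M' N'"
    proof (rule image_tensor_relations_subset)
      fix x x' y assume xy: "x \<in> carrier M" "x' \<in> carrier M" "y \<in> carrier N"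
      have "f x \<in> carrier M'" "f x' \<in> carrier M'" "g y \<in> carrier N'"
        "f (x \<oplus>\<^bsub>M\<^esub> x') = f x \<oplus>\<^bsub>M'\<^esub> f x'"
        using xy f g by (auto simp: right_hom_def left_hom_def)
      then show "tensor_frag f g (frag_of (x \<oplus>\<^bsub>M\<^esub> x', y) - (frag_of (x, y) + frag_of (x', y)))
          \<in> tensor_relations S M' N'"
        by (simp add: tensor_frag_diff tensor_frag_add tensor_relations_I xy del: add_diff_cancel_left' diff_diff_add)
    next
      fix x y y' assume xy: "x \<in> carrier M" "y \<in> carrier N" "y' \<in> carrier N"
      have "f x \<in> carrier M'" "g y \<in> carrier N'" "g y' \<in> carrier N'"
        "g (y \<oplus>\<^bsub>N\<^esub> y') = g y \<oplus>\<^bsub>N'\<^esub> g y'"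
        using xy f g by (auto simp: right_hom_def left_hom_def)
      then show "tensor_frag f g (frag_of (x, y \<oplus>\<^bsub>N\<^esub> y') - (frag_of (x, y) + frag_of (x, y')))
          \<in> tensor_relations S M' N'"
        by (simp add: tensor_frag_diff tensor_frag_add tensor_relations_I xy del: add_diff_cancel_left' diff_diff_add)
    next
      fix x b y assume xy: "x \<in> carrier M" "b \<in> carrier S" "y \<in> carrier N"
      have "f x \<in> carrier M'" "g y \<in> carrier N'"
        "f (x \<bullet>\<^bsub>M\<^esub> b) = f x \<bullet>\<^bsub>M'\<^esub> b" "g (b \<odot>\<^bsub>N\<^esub> y) = b \<odot>\<^bsub>N'\<^esub> g y"
        using xy f g by (auto simp: right_hom_def left_hom_def)
      then show "tensor_frag f g (frag_of (x \<bullet>\<^bsub>M\<^esub> b, y) - frag_of (x, b \<odot>\<^bsub>N\<^esub> y))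
          \<in> tensor_relations S M' N'"
        by (simp add: tensor_frag_diff tensor_frag_add tensor_relations_I xy del: add_diff_cancel_left' diff_diff_add)
    qed
    then show "tensor_frag f g ` tensor_relations S M N \<subseteq> P'.K"
      by (auto simp: tensor_subgroup_def intro: generate.incl)
  qed
  from induced_map_tensor_class[OF tensor_frag_add c P'.tensor_subgroup_subgroup this]
  show ?thesis by (simp add: tensor_class_def)
qed

context tensor_pair
begin

lemma smult_tensor_class:
  assumes a: "a \<in> carrier R" and c: "Poly_Mapping.keys c \<subseteq> pairs"
  shows "a \<odot>\<^bsub>tensor_product S M N\<^esub> tclass c = tclass (tensor_frag (\<lambda>x. a \<odot>\<^bsub>M\<^esub> x) (\<lambda>y. y) c)"
proof -
  have "(\<lambda>x. a \<odot>\<^bsub>M\<^esub> x) \<in> right_hom S M M" "(\<lambda>y. y) \<in> left_hom S N N"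
    using a by (auto simp: right_hom_def left_hom_def L.smult_closed L.smult_r_distr L.smult_rsmult)
  from tensor_frag_tensor_class[OF tensor_pair_axioms this c]
  show ?thesis
    by (simp add: tensor_product_def Let_def tensor_frag_def)
qed

lemma rsmult_tensor_class:
  assumes r: "r \<in> carrier T" and c: "Poly_Mapping.keys c \<subseteq> pairs"
  shows "tclass c \<bullet>\<^bsub>tensor_product S M N\<^esub> r = tclass (tensor_frag (\<lambda>x. x) (\<lambda>y. y \<bullet>\<^bsub>N\<^esub> r) c)"
proof -
  have "(\<lambda>x. x) \<in> right_hom S M M" "(\<lambda>y. y \<bullet>\<^bsub>N\<^esub> r) \<in> left_hom S N N"
    using r by (auto simp: right_hom_def left_hom_def N.rsmult_closed N.rsmult_l_distr N.smult_rsmult)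
  from tensor_frag_tensor_class[OF tensor_pair_axioms this c]
  show ?thesis
    by (simp add: tensor_product_def Let_def tensor_frag_def)
qed

lemma smult_pure:
  "\<lbrakk>a \<in> carrier R; x \<in> carrier M; y \<in> carrier N\<rbrakk>
    \<Longrightarrow> a \<odot>\<^bsub>tensor_product S M N\<^esub> pure x y = pure (a \<odot>\<^bsub>M\<^esub> x) y"
  by (simp add: smult_tensor_class)

lemma rsmult_pure:
  "\<lbrakk>x \<in> carrier M; y \<in> carrier N; r \<in> carrier T\<rbrakk>
    \<Longrightarrow> pure x y \<bullet>\<^bsub>tensor_product S M N\<^esub> r = pure x (y \<bullet>\<^bsub>N\<^esub> r)"
  by (simp add: rsmult_tensor_class)

lemma keys_smult:
  assumes "a \<in> carrier R" "Poly_Mapping.keys c \<subseteq> pairs"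
  shows "Poly_Mapping.keys (tensor_frag (\<lambda>x. a \<odot>\<^bsub>M\<^esub> x) (\<lambda>y. y) c) \<subseteq> pairs"
  by (rule keys_tensor_frag[OF _ _ assms(2)]) (use assms(1) in \<open>auto simp: L.smult_closed\<close>)

lemma keys_rsmult:
  assumes "r \<in> carrier T" "Poly_Mapping.keys c \<subseteq> pairs"
  shows "Poly_Mapping.keys (tensor_frag (\<lambda>x. x) (\<lambda>y. y \<bullet>\<^bsub>N\<^esub> r) c) \<subseteq> pairs"
  by (rule keys_tensor_frag[OF _ _ assms(2)]) (use assms(1) in \<open>auto simp: N.rsmult_closed\<close>)

end

definition tensor_map ::
  "('b, 's) ring_scheme \<Rightarrow> ('a, 'b, 'm2, 'x) bimodule_scheme \<Rightarrow> ('b, 'c, 'n2, 'y) bimodule_scheme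
    \<Rightarrow> ('m \<Rightarrow> 'm2) \<Rightarrow> ('n \<Rightarrow> 'n2) \<Rightarrow> ('m \<times> 'n \<Rightarrow>\<^sub>0 int) set \<Rightarrow> ('m2 \<times> 'n2 \<Rightarrow>\<^sub>0 int) set"
  where "tensor_map S M' N' f g C =
    tensor_subgroup S M' N' <#>\<^bsub>free_Abelian_group (carrier M' \<times> carrier N')\<^esub> (tensor_frag f g ` C)"

lemma bimodule_homD:
  assumes "f \<in> bimodule_hom R S M N"
  shows "f \<in> left_hom R M N" "f \<in> right_hom S M N" "f \<in> carrier M \<rightarrow> carrier N"
    "x \<in> carrier M \<Longrightarrow> f x \<in> carrier N"
    "\<lbrakk>x \<in> carrier M; y \<in> carrier M\<rbrakk> \<Longrightarrow> f (x \<oplus>\<^bsub>M\<^esub> y) = f x \<oplus>\<^bsub>N\<^esub> f y"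
    "\<lbrakk>a \<in> carrier R; x \<in> carrier M\<rbrakk> \<Longrightarrow> f (a \<odot>\<^bsub>M\<^esub> x) = a \<odot>\<^bsub>N\<^esub> f x"
    "\<lbrakk>x \<in> carrier M; b \<in> carrier S\<rbrakk> \<Longrightarrow> f (x \<bullet>\<^bsub>M\<^esub> b) = f x \<bullet>\<^bsub>N\<^esub> b"
  using assms by (auto simp: bimodule_hom_def left_hom_def right_hom_def)

lemma bimodule_homI:
  assumes "\<And>x. x \<in> carrier M \<Longrightarrow> f x \<in> carrier N"
    "\<And>x y. \<lbrakk>x \<in> carrier M; y \<in> carrier M\<rbrakk> \<Longrightarrow> f (x \<oplus>\<^bsub>M\<^esub> y) = f x \<oplus>\<^bsub>N\<^esub> f y"
    "\<And>a x. \<lbrakk>a \<in> carrier R; x \<in> carrier M\<rbrakk> \<Longrightarrow> f (a \<odot>\<^bsub>M\<^esub> x) = a \<odot>\<^bsub>N\<^esub> f x"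
    "\<And>x b. \<lbrakk>x \<in> carrier M; b \<in> carrier S\<rbrakk> \<Longrightarrow> f (x \<bullet>\<^bsub>M\<^esub> b) = f x \<bullet>\<^bsub>N\<^esub> b"
  shows "f \<in> bimodule_hom R S M N"
  using assms by (auto simp: bimodule_hom_def left_hom_def right_hom_def)

lemma bimodule_hom_ident: "(\<lambda>x. x) \<in> bimodule_hom R S M M"
  by (rule bimodule_homI) simp_all

lemma bimodule_hom_compose:
  assumes "f \<in> bimodule_hom R S M N" "g \<in> bimodule_hom R S N P"
  shows "(\<lambda>x. g (f x)) \<in> bimodule_hom R S M P"
  by (rule bimodule_homI) (simp_all add: bimodule_homD[OF assms(1)] bimodule_homD[OF assms(2)])

context tensor_pair
begin

lemma tensor_map_tensor_class:
  assumes "tensor_pair R S T M' N'" "f \<in> bimodule_hom R S M M'" "g \<in> bimodule_hom S T N N'"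
    and "Poly_Mapping.keys c \<subseteq> pairs"
  shows "tensor_map S M' N' f g (tclass c) = tensor_class S M' N' (tensor_frag f g c)"
  unfolding tensor_map_def
  by (rule tensor_frag_tensor_class) (use assms in \<open>auto dest: bimodule_homD\<close>)

lemma tensor_map_bimodule_hom:
  assumes P': "tensor_pair R S T M' N'"
    and f: "f \<in> bimodule_hom R S M M'" and g: "g \<in> bimodule_hom S T N N'"
  shows "tensor_map S M' N' f g \<in> bimodule_hom R T (tensor_product S M N) (tensor_product S M' N')"
proof -
  interpret P': tensor_pair R S T M' N' by fact
  note fs = bimodule_homD[OF f] and gs = bimodule_homD[OF g]
  note map = tensor_map_tensor_class[OF P' f g]
  have keys: "Poly_Mapping.keys (tensor_frag f g c) \<subseteq> P'.pairs" if "Poly_Mapping.keys c \<subseteq> pairs" for c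
    by (rule keys_tensor_frag[OF fs(3) gs(3) that])
  show ?thesis
  proof (rule bimodule_homI; (unfold carrier_tensor_product, elim imageE, unfold carrier_free_Abelian_group_iff)?)
    fix C c assume "C = tclass c" "Poly_Mapping.keys c \<subseteq> pairs"
    then show "tensor_map S M' N' f g C \<in> carrier (tensor_product S M' N')"
      by (simp add: map keys P'.tensor_class_in_carrier)
  next
    fix C D c d
    assume "C = tclass c" "Poly_Mapping.keys c \<subseteq> pairs" "D = tclass d" "Poly_Mapping.keys d \<subseteq> pairs"
    moreover from this have "Poly_Mapping.keys (c + d) \<subseteq> pairs"
      using keys_add[of c d] by blast
    ultimately show "tensor_map S M' N' f g (C \<oplus>\<^bsub>tensor_product S M N\<^esub> D) =
        tensor_map S M' N' f g C \<oplus>\<^bsub>tensor_product S M' N'\<^esub> tensor_map S M' N' f g D"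
      by (simp add: map add_tensor_class P'.add_tensor_class keys tensor_frag_add)
  next
    fix a C c assume a: "a \<in> carrier R" and C: "C = tclass c" and c: "Poly_Mapping.keys c \<subseteq> pairs"
    have "tensor_frag f g (tensor_frag (\<lambda>x. a \<odot>\<^bsub>M\<^esub> x) (\<lambda>y. y) c) =
        tensor_frag (\<lambda>x. a \<odot>\<^bsub>M'\<^esub> x) (\<lambda>y. y) (tensor_frag f g c)"
      unfolding tensor_frag_compose by (rule tensor_frag_cong[OF c]) (simp_all add: fs a)
    then show "tensor_map S M' N' f g (a \<odot>\<^bsub>tensor_product S M N\<^esub> C) =
        a \<odot>\<^bsub>tensor_product S M' N'\<^esub> tensor_map S M' N' f g C"
      by (simp add: C map a c smult_tensor_class P'.smult_tensor_class keys keys_smult)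
  next
    fix C r c assume r: "r \<in> carrier T" and C: "C = tclass c" and c: "Poly_Mapping.keys c \<subseteq> pairs"
    have "tensor_frag f g (tensor_frag (\<lambda>x. x) (\<lambda>y. y \<bullet>\<^bsub>N\<^esub> r) c) =
        tensor_frag (\<lambda>x. x) (\<lambda>y. y \<bullet>\<^bsub>N'\<^esub> r) (tensor_frag f g c)"
      unfolding tensor_frag_compose by (rule tensor_frag_cong[OF c]) (simp_all add: gs r)
    then show "tensor_map S M' N' f g (C \<bullet>\<^bsub>tensor_product S M N\<^esub> r) =
        tensor_map S M' N' f g C \<bullet>\<^bsub>tensor_product S M' N'\<^esub> r"
      by (simp add: C map r c rsmult_tensor_class P'.rsmult_tensor_class keys keys_rsmult)
  qed
qed

end

section \<open>The universal property\<close>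

text \<open>
  The sum over the support is an additive function on the free abelian group, and balancedness
  makes it vanish on the relations. It is thus constant on every coset, whose image is the
  singleton from which \<^const>\<open>tensor_lift\<close> extracts its value.
\<close>

lemma (in tensor_pair)
  fixes W :: "('w, 'z) ring_scheme"
  assumes W: "abelian_group W"
    and closed: "\<And>x y. \<lbrakk>x \<in> carrier M; y \<in> carrier N\<rbrakk> \<Longrightarrow> h x y \<in> carrier W"
    and add_left: "\<And>x x' y. \<lbrakk>x \<in> carrier M; x' \<in> carrier M; y \<in> carrier N\<rbrakk>
      \<Longrightarrow> h (x \<oplus>\<^bsub>M\<^esub> x') y = h x y \<oplus>\<^bsub>W\<^esub> h x' y"
    and add_right: "\<And>x y y'. \<lbrakk>x \<in> carrier M; y \<in> carrier N; y' \<in> carrier N\<rbrakk>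
      \<Longrightarrow> h x (y \<oplus>\<^bsub>N\<^esub> y') = h x y \<oplus>\<^bsub>W\<^esub> h x y'"
    and balanced: "\<And>x b y. \<lbrakk>x \<in> carrier M; b \<in> carrier S; y \<in> carrier N\<rbrakk>
      \<Longrightarrow> h (x \<bullet>\<^bsub>M\<^esub> b) y = h x (b \<odot>\<^bsub>N\<^esub> y)"
  shows tensor_lift_hom: "(\<lambda>c. tensor_lift W h (tensor_class S M N c))
      \<in> hom (free_Abelian_group (carrier M \<times> carrier N)) (add_monoid W)"
    and tensor_lift_pure: "\<lbrakk>x \<in> carrier M; y \<in> carrier N\<rbrakk>
      \<Longrightarrow> tensor_lift W h (tensor_class S M N (frag_of (x, y))) = h x y"
proof -
  interpret W: abelian_group W by fact
  define L :: "('m \<times> 'n \<Rightarrow>\<^sub>0 int) \<Rightarrow> 'w" where "L = (\<lambda>c. \<Oplus>\<^bsub>W\<^esub>z\<in>Poly_Mapping.keys c.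
    [Poly_Mapping.lookup c z] \<cdot>\<^bsub>W\<^esub> h (fst z) (snd z))"
  have h: "(\<lambda>z. h (fst z) (snd z)) \<in> pairs \<rightarrow> carrier (add_monoid W)"
    using closed by auto
  have L: "L \<in> hom F (add_monoid W)"
    using comm_group.free_Abelian_group_extension_hom(1)[OF W.a_comm_group h]
    unfolding L_def finsum_def add_pow_def by simp
  have L_pure: "L (frag_of (x, y)) = h x y" if "x \<in> carrier M" "y \<in> carrier N" for x y
    using comm_group.free_Abelian_group_extension_hom(2)[OF W.a_comm_group h, of "(x, y)"] that
    unfolding L_def finsum_def add_pow_def by simp
  interpret L: group_hom F "add_monoid W" L
    using L W.a_group by (simp add: group_hom_def group_hom_axioms_def)
  have L_add: "L (c + d) = L c \<oplus>\<^bsub>W\<^esub> L d"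
    if "Poly_Mapping.keys c \<subseteq> pairs" "Poly_Mapping.keys d \<subseteq> pairs" for c d
    using L.hom_mult[of c d] that by simp
  have L_diff: "L (c - d) = \<zero>\<^bsub>W\<^esub>"
    if "Poly_Mapping.keys c \<subseteq> pairs" "Poly_Mapping.keys d \<subseteq> pairs" "L c = L d" for c d
    using L.hom_mult[of c "- d"] L.hom_inv[of d] L.hom_closed[of d] that
    by (simp add: W.add.r_inv)
  have keys: "Poly_Mapping.keys (frag_of p + frag_of q) \<subseteq> pairs" if "p \<in> pairs" "q \<in> pairs" for p q
    using keys_add[of "frag_of p" "frag_of q"] that by auto
  have "L ` tensor_relations S M N \<subseteq> {\<zero>\<^bsub>W\<^esub>}"
    by (rule image_tensor_relations_subset; unfold singleton_iff; rule L_diff)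
      (simp_all add: keys L_add L_pure add_left add_right balanced L.rsmult_closed N.smult_closed)
  then have "L ` K \<subseteq> {\<zero>\<^bsub>W\<^esub>}"
    by (intro hom_tensor_subgroup[OF W.a_group _ L] group.triv_subgroup[OF W.a_group, simplified]) auto
  then have LK: "L (k + c) = L c" if "k \<in> K" "Poly_Mapping.keys c \<subseteq> pairs" for k c
    using that L_add[of k c] subgroup.mem_carrier[OF tensor_subgroup_subgroup that(1)] L.hom_closed[of c]
    by auto
  have lift: "tensor_lift W h (tclass c) = L c" if "Poly_Mapping.keys c \<subseteq> pairs" for c
  proof -
    have "L ` tclass c = {L c}"
      using LK[OF _ that] subgroup.one_closed[OF tensor_subgroup_subgroup]
      by (auto simp: tensor_class_alt image_image)
    then show ?thesis
      by (simp add: tensor_lift_def L_def)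
  qed
  show "(\<lambda>c. tensor_lift W h (tclass c)) \<in> hom F (add_monoid W)"
  proof (rule homI)
    fix c d assume cd: "c \<in> carrier F" "d \<in> carrier F"
    then have "Poly_Mapping.keys (c + d) \<subseteq> pairs"
      using keys_add[of c d] by auto
    with cd show "tensor_lift W h (tclass (c \<otimes>\<^bsub>F\<^esub> d)) =
        tensor_lift W h (tclass c) \<otimes>\<^bsub>add_monoid W\<^esub> tensor_lift W h (tclass d)"
      by (simp add: lift L_add)
  qed (use L.hom_closed in \<open>simp add: lift\<close>)
  show "tensor_lift W h (pure x y) = h x y" if "x \<in> carrier M" "y \<in> carrier N"
    using that by (simp add: lift L_pure)
qed

section \<open>Balanced pairings\<close>

text \<open>
  These are the data of a bimodule homomorphism from \<open>M \<otimes> N\<close> to the regular bimodule of \<open>R\<close>: each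
  such homomorphism restricts to a balanced pairing on pure tensors
  (\<open>balanced_pairing_of_hom\<close>), and each balanced pairing lifts to one
  (\<open>tensor_lift_bimodule_hom\<close>).
\<close>

locale balanced_pairing = tensor_pair R S R M N
  for R :: "('a, 'r) ring_scheme" and S :: "('b, 's) ring_scheme"
    and M :: "('a, 'b, 'm, 'x) bimodule_scheme" and N :: "('b, 'a, 'n, 'y) bimodule_scheme" +
  fixes \<beta> :: "'m \<Rightarrow> 'n \<Rightarrow> 'a"
  assumes closed: "\<lbrakk>x \<in> carrier M; y \<in> carrier N\<rbrakk> \<Longrightarrow> \<beta> x y \<in> carrier R"
    and add_left: "\<lbrakk>x \<in> carrier M; x' \<in> carrier M; y \<in> carrier N\<rbrakk>
      \<Longrightarrow> \<beta> (x \<oplus>\<^bsub>M\<^esub> x') y = \<beta> x y \<oplus>\<^bsub>R\<^esub> \<beta> x' y"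
    and add_right: "\<lbrakk>x \<in> carrier M; y \<in> carrier N; y' \<in> carrier N\<rbrakk>
      \<Longrightarrow> \<beta> x (y \<oplus>\<^bsub>N\<^esub> y') = \<beta> x y \<oplus>\<^bsub>R\<^esub> \<beta> x y'"
    and balanced: "\<lbrakk>x \<in> carrier M; b \<in> carrier S; y \<in> carrier N\<rbrakk>
      \<Longrightarrow> \<beta> (x \<bullet>\<^bsub>M\<^esub> b) y = \<beta> x (b \<odot>\<^bsub>N\<^esub> y)"
    and smult_left: "\<lbrakk>a \<in> carrier R; x \<in> carrier M; y \<in> carrier N\<rbrakk>
      \<Longrightarrow> \<beta> (a \<odot>\<^bsub>M\<^esub> x) y = a \<otimes>\<^bsub>R\<^esub> \<beta> x y"
    and smult_right: "\<lbrakk>x \<in> carrier M; y \<in> carrier N; a \<in> carrier R\<rbrakk>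
      \<Longrightarrow> \<beta> x (y \<bullet>\<^bsub>N\<^esub> a) = \<beta> x y \<otimes>\<^bsub>R\<^esub> a"

lemma regular_bimodule_simps [simp]:
  "carrier (regular_bimodule R) = carrier R"
  "add (regular_bimodule R) = add R"
  "smult (regular_bimodule R) = mult R"
  "rsmult (regular_bimodule R) = mult R"
  by (simp_all add: regular_bimodule_def)

context balanced_pairing
begin

lemma lift_hom: "(\<lambda>c. tensor_lift R \<beta> (tclass c)) \<in> hom F (add_monoid R)"
  by (rule tensor_lift_hom[OF L.R.is_abelian_group])
    (simp_all add: closed add_left add_right balanced)

lemma lift_pure: "\<lbrakk>x \<in> carrier M; y \<in> carrier N\<rbrakk> \<Longrightarrow> tensor_lift R \<beta> (pure x y) = \<beta> x y"
  by (rule tensor_lift_pure[OF L.R.is_abelian_group])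
    (simp_all add: closed add_left add_right balanced)

lemma tensor_lift_bimodule_hom:
  "tensor_lift R \<beta> \<in> bimodule_hom R R (tensor_product S M N) (regular_bimodule R)"
proof (rule bimodule_homI; (unfold carrier_tensor_product, elim imageE, unfold carrier_free_Abelian_group_iff)?)
  note closed_lift = hom_in_carrier[OF lift_hom, simplified]
  fix C c assume C: "C = tclass c" and c: "Poly_Mapping.keys c \<subseteq> pairs"
  show "tensor_lift R \<beta> C \<in> carrier (regular_bimodule R)"
    using closed_lift C c by simp
  show "tensor_lift R \<beta> (C \<oplus>\<^bsub>tensor_product S M N\<^esub> D) =
      tensor_lift R \<beta> C \<oplus>\<^bsub>regular_bimodule R\<^esub> tensor_lift R \<beta> D"
    if "D = tclass d" "Poly_Mapping.keys d \<subseteq> pairs" for D d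
    using hom_mult[OF lift_hom, of c d] C c that by (simp add: add_tensor_class)
  show "tensor_lift R \<beta> (a \<odot>\<^bsub>tensor_product S M N\<^esub> C) =
      a \<odot>\<^bsub>regular_bimodule R\<^esub> tensor_lift R \<beta> C" if a: "a \<in> carrier R" for a
  proof -
    \<comment> \<open>Both sides are additive in \<open>c\<close>, so the identity needs checking on basis pairs only.\<close>
    have "tensor_lift R \<beta> (tclass (tensor_frag (\<lambda>x. a \<odot>\<^bsub>M\<^esub> x) (\<lambda>y. y) c)) =
        a \<otimes>\<^bsub>R\<^esub> tensor_lift R \<beta> (tclass c)"
    proof (rule hom_free_Abelian_group_cong[OF L.R.a_group _ _ _ c])
      show "(\<lambda>c. tensor_lift R \<beta> (tclass (tensor_frag (\<lambda>x. a \<odot>\<^bsub>M\<^esub> x) (\<lambda>y. y) c)))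
          \<in> hom F (add_monoid R)"
        by (rule hom_compose[OF tensor_frag_in_hom lift_hom, unfolded comp_def])
          (use a in \<open>auto simp: L.smult_closed\<close>)
      show "(\<lambda>c. a \<otimes>\<^bsub>R\<^esub> tensor_lift R \<beta> (tclass c)) \<in> hom F (add_monoid R)"
        by (rule homI)
          (use a hom_mult[OF lift_hom] closed_lift in \<open>auto simp: L.R.r_distr\<close>)
      show "tensor_lift R \<beta> (tclass (tensor_frag (\<lambda>x. a \<odot>\<^bsub>M\<^esub> x) (\<lambda>y. y) (frag_of z))) =
        a \<otimes>\<^bsub>R\<^esub> tensor_lift R \<beta> (tclass (frag_of z))" if "z \<in> pairs" for z
        using that a by (cases z) (simp add: lift_pure L.smult_closed smult_left)
    qed
    then show ?thesis
      using a c C by (simp add: smult_tensor_class)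
  qed
  show "tensor_lift R \<beta> (C \<bullet>\<^bsub>tensor_product S M N\<^esub> a) =
      tensor_lift R \<beta> C \<bullet>\<^bsub>regular_bimodule R\<^esub> a" if a: "a \<in> carrier R" for a
  proof -
    have "tensor_lift R \<beta> (tclass (tensor_frag (\<lambda>x. x) (\<lambda>y. y \<bullet>\<^bsub>N\<^esub> a) c)) =
        tensor_lift R \<beta> (tclass c) \<otimes>\<^bsub>R\<^esub> a"
    proof (rule hom_free_Abelian_group_cong[OF L.R.a_group _ _ _ c])
      show "(\<lambda>c. tensor_lift R \<beta> (tclass (tensor_frag (\<lambda>x. x) (\<lambda>y. y \<bullet>\<^bsub>N\<^esub> a) c)))
          \<in> hom F (add_monoid R)"
        by (rule hom_compose[OF tensor_frag_in_hom lift_hom, unfolded comp_def])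
          (use a in \<open>auto simp: N.rsmult_closed\<close>)
      show "(\<lambda>c. tensor_lift R \<beta> (tclass c) \<otimes>\<^bsub>R\<^esub> a) \<in> hom F (add_monoid R)"
        by (rule homI)
          (use a hom_mult[OF lift_hom] closed_lift in \<open>auto simp: L.R.l_distr\<close>)
      show "tensor_lift R \<beta> (tclass (tensor_frag (\<lambda>x. x) (\<lambda>y. y \<bullet>\<^bsub>N\<^esub> a) (frag_of z))) =
        tensor_lift R \<beta> (tclass (frag_of z)) \<otimes>\<^bsub>R\<^esub> a" if "z \<in> pairs" for z
        using that a by (cases z) (simp add: lift_pure N.rsmult_closed smult_right)
    qed
    then show ?thesis
      using a c C by (simp add: rsmult_tensor_class)
  qed
qed

text \<open>
  On pure tensors, hence everywhere, \<open>\<nu>\<close> is \<open>f \<otimes> g\<close> followed by the lift of \<open>\<beta>\<close>. So \<open>f \<otimes> g\<close>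
  carries a section of \<open>\<nu>\<close> to a section of the lift.
\<close>

theorem split_epi_tensor_lift:
  fixes M\<^sub>0 :: "('a, 'b, 'm0, 'x0) bimodule_scheme" and N\<^sub>0 :: "('b, 'a, 'n0, 'y0) bimodule_scheme"
  assumes P0: "tensor_pair R S R M\<^sub>0 N\<^sub>0"
    and f: "f \<in> bimodule_hom R S M\<^sub>0 M" and g: "g \<in> bimodule_hom S R N\<^sub>0 N"
    and \<nu>: "split_bimodule_epi R R (tensor_product S M\<^sub>0 N\<^sub>0) (regular_bimodule R) \<nu>"
    and factor: "\<And>x y. \<lbrakk>x \<in> carrier M\<^sub>0; y \<in> carrier N\<^sub>0\<rbrakk>
      \<Longrightarrow> \<nu> (tensor_class S M\<^sub>0 N\<^sub>0 (frag_of (x, y))) = \<beta> (f x) (g y)"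
  shows "split_bimodule_epi R R (tensor_product S M N) (regular_bimodule R) (tensor_lift R \<beta>)"
proof -
  interpret P0: tensor_pair R S R M\<^sub>0 N\<^sub>0 by fact
  note fs = bimodule_homD[OF f] and gs = bimodule_homD[OF g]
  from \<nu> obtain s where s: "s \<in> bimodule_hom R R (regular_bimodule R) (tensor_product S M\<^sub>0 N\<^sub>0)"
    and \<nu>s: "\<And>r. r \<in> carrier R \<Longrightarrow> \<nu> (s r) = r"
    and \<nu>_hom: "\<nu> \<in> bimodule_hom R R (tensor_product S M\<^sub>0 N\<^sub>0) (regular_bimodule R)"
    by (auto simp: split_bimodule_epi_def)
  note \<nu>s' = bimodule_homD[OF \<nu>_hom]
  have "tensor_lift R \<beta> (tensor_class S M N (tensor_frag f g c)) = \<nu> (tensor_class S M\<^sub>0 N\<^sub>0 c)"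
    if "Poly_Mapping.keys c \<subseteq> P0.pairs" for c
  proof (rule hom_free_Abelian_group_cong[OF L.R.a_group _ _ _ that])
    show "(\<lambda>c. tensor_lift R \<beta> (tclass (tensor_frag f g c))) \<in> hom P0.F (add_monoid R)"
      by (rule hom_compose[OF tensor_frag_in_hom[OF fs(3) gs(3)] lift_hom, unfolded comp_def])
    show "(\<lambda>c. \<nu> (tensor_class S M\<^sub>0 N\<^sub>0 c)) \<in> hom P0.F (add_monoid R)"
      by (rule homI)
        (use \<nu>s'(4) in \<open>auto simp: \<nu>s'(5) P0.tensor_class_in_carrier simp flip: P0.add_tensor_class\<close>)
  qed (use factor in \<open>auto simp: lift_pure fs gs\<close>)
  then have "tensor_lift R \<beta> (tensor_map S M N f g C) = \<nu> C"
    if "C \<in> carrier (tensor_product S M\<^sub>0 N\<^sub>0)" for C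
    using that
    by (auto simp: P0.carrier_tensor_product P0.tensor_map_tensor_class[OF tensor_pair_axioms f g])
  then have "tensor_lift R \<beta> (tensor_map S M N f g (s r)) = r" if "r \<in> carrier R" for r
    using that \<nu>s bimodule_homD(4)[OF s] by simp
  moreover have "(\<lambda>r. tensor_map S M N f g (s r))
      \<in> bimodule_hom R R (regular_bimodule R) (tensor_product S M N)"
    by (rule bimodule_hom_compose[OF s P0.tensor_map_bimodule_hom[OF tensor_pair_axioms f g]])
  ultimately show ?thesis
    using tensor_lift_bimodule_hom unfolding split_bimodule_epi_def regular_bimodule_simps
    by (intro conjI bexI ballI)
qed

end

section \<open>Dual bimodules and their evaluation pairings\<close>

lemma left_dual_simps [simp]:
  "carrier (left_dual A V) = left_hom A V (regular_bimodule A) \<inter> extensional (carrier V)"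
  "\<zero>\<^bsub>left_dual A V\<^esub> = (\<lambda>v\<in>carrier V. \<zero>\<^bsub>A\<^esub>)"
  "f \<oplus>\<^bsub>left_dual A V\<^esub> g = (\<lambda>v\<in>carrier V. f v \<oplus>\<^bsub>A\<^esub> g v)"
  "b \<odot>\<^bsub>left_dual A V\<^esub> f = (\<lambda>v\<in>carrier V. f (v \<bullet>\<^bsub>V\<^esub> b))"
  "f \<bullet>\<^bsub>left_dual A V\<^esub> a = (\<lambda>v\<in>carrier V. f v \<otimes>\<^bsub>A\<^esub> a)"
  by (simp_all add: left_dual_def)

lemma right_dual_simps [simp]:
  "carrier (right_dual B V) = right_hom B V (regular_bimodule B) \<inter> extensional (carrier V)"
  "\<zero>\<^bsub>right_dual B V\<^esub> = (\<lambda>v\<in>carrier V. \<zero>\<^bsub>B\<^esub>)"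
  "f \<oplus>\<^bsub>right_dual B V\<^esub> g = (\<lambda>v\<in>carrier V. f v \<oplus>\<^bsub>B\<^esub> g v)"
  "b \<odot>\<^bsub>right_dual B V\<^esub> f = (\<lambda>v\<in>carrier V. b \<otimes>\<^bsub>B\<^esub> f v)"
  "f \<bullet>\<^bsub>right_dual B V\<^esub> a = (\<lambda>v\<in>carrier V. f (a \<odot>\<^bsub>V\<^esub> v))"
  by (simp_all add: right_dual_def)

lemma mem_left_dual_iff:
  "f \<in> left_hom A V (regular_bimodule A) \<longleftrightarrow> f \<in> carrier V \<rightarrow> carrier A \<and>
    (\<forall>x\<in>carrier V. \<forall>y\<in>carrier V. f (x \<oplus>\<^bsub>V\<^esub> y) = f x \<oplus>\<^bsub>A\<^esub> f y) \<and>
    (\<forall>a\<in>carrier A. \<forall>x\<in>carrier V. f (a \<odot>\<^bsub>V\<^esub> x) = a \<otimes>\<^bsub>A\<^esub> f x)"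
  by (simp add: left_hom_def)

lemma mem_right_dual_iff:
  "f \<in> right_hom B V (regular_bimodule B) \<longleftrightarrow> f \<in> carrier V \<rightarrow> carrier B \<and>
    (\<forall>x\<in>carrier V. \<forall>y\<in>carrier V. f (x \<oplus>\<^bsub>V\<^esub> y) = f x \<oplus>\<^bsub>B\<^esub> f y) \<and>
    (\<forall>x\<in>carrier V. \<forall>b\<in>carrier B. f (x \<bullet>\<^bsub>V\<^esub> b) = f x \<otimes>\<^bsub>B\<^esub> b)"
  by (simp add: right_hom_def)

lemma (in bimodule) bimodule_left_dual: "bimodule S R (left_dual R M)"
proof -
  note [simp] = mem_left_dual_iff smult_closed smult_l_distr smult_r_distr smult_assoc smult_one
    rsmult_closed rsmult_r_distr rsmult_l_distr rsmult_assoc rsmult_one smult_rsmult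
    R.l_distr R.r_distr R.m_assoc Pi_iff
  have "abelian_group (left_dual R M)"
  proof (rule abelian_groupI)
    fix f assume f: "f \<in> carrier (left_dual R M)"
    then have "(\<lambda>v\<in>carrier M. \<ominus>\<^bsub>R\<^esub> f v) \<in> carrier (left_dual R M)"
      by (auto simp: R.minus_add R.r_minus)
    moreover have "(\<lambda>v\<in>carrier M. \<ominus>\<^bsub>R\<^esub> f v) \<oplus>\<^bsub>left_dual R M\<^esub> f = \<zero>\<^bsub>left_dual R M\<^esub>"
      using f by (auto simp: R.l_neg)
    ultimately show "\<exists>g\<in>carrier (left_dual R M). g \<oplus>\<^bsub>left_dual R M\<^esub> f = \<zero>\<^bsub>left_dual R M\<^esub>" by blast
  qed (auto simp: R.a_ac intro!: extensionalityI[of _ "carrier M"])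
  then show ?thesis
    by (intro bimodule.intro left_module.intro right_module.intro S.ring_axioms R.ring_axioms
        left_module_axioms.intro right_module_axioms.intro bimodule_axioms.intro)
      (auto simp: R.a_ac intro!: extensionalityI[of _ "carrier M"])
qed

lemma (in bimodule) bimodule_right_dual: "bimodule S R (right_dual S M)"
proof -
  note [simp] = mem_right_dual_iff smult_closed smult_l_distr smult_r_distr smult_assoc smult_one
    rsmult_closed rsmult_r_distr rsmult_l_distr rsmult_assoc rsmult_one smult_rsmult[symmetric]
    S.l_distr S.r_distr S.m_assoc Pi_iff
  have "abelian_group (right_dual S M)"
  proof (rule abelian_groupI)
    fix f assume f: "f \<in> carrier (right_dual S M)"
    then have "(\<lambda>v\<in>carrier M. \<ominus>\<^bsub>S\<^esub> f v) \<in> carrier (right_dual S M)"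
      by (auto simp: S.minus_add S.l_minus)
    moreover have "(\<lambda>v\<in>carrier M. \<ominus>\<^bsub>S\<^esub> f v) \<oplus>\<^bsub>right_dual S M\<^esub> f = \<zero>\<^bsub>right_dual S M\<^esub>"
      using f by (auto simp: S.l_neg)
    ultimately show "\<exists>g\<in>carrier (right_dual S M). g \<oplus>\<^bsub>right_dual S M\<^esub> f = \<zero>\<^bsub>right_dual S M\<^esub>" by blast
  qed (auto simp: S.a_ac intro!: extensionalityI[of _ "carrier M"])
  then show ?thesis
    by (intro bimodule.intro left_module.intro right_module.intro S.ring_axioms R.ring_axioms
        left_module_axioms.intro right_module_axioms.intro bimodule_axioms.intro)
      (auto simp: S.a_ac intro!: extensionalityI[of _ "carrier M"])
qed

lemma (in bimodule) left_dual_evaluation: "balanced_pairing R S M (left_dual R M) (\<lambda>v f. f v)"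
  by (intro balanced_pairing.intro tensor_pair.intro bimodule_left_dual bimodule_axioms
      balanced_pairing_axioms.intro)
    (auto simp: mem_left_dual_iff)

lemma (in bimodule) right_dual_evaluation: "balanced_pairing S R (right_dual S M) M (\<lambda>g v. g v)"
  by (intro balanced_pairing.intro tensor_pair.intro bimodule_right_dual bimodule_axioms
      balanced_pairing_axioms.intro)
    (auto simp: mem_right_dual_iff)

lemma balanced_pairing_of_hom:
  assumes "tensor_pair R S R M N"
    and \<nu>: "\<nu> \<in> bimodule_hom R R (tensor_product S M N) (regular_bimodule R)"
  shows "balanced_pairing R S M N (\<lambda>x y. \<nu> (tensor_class S M N (frag_of (x, y))))"
proof -
  interpret tensor_pair R S R M N by fact
  note \<nu>s = bimodule_homD[OF \<nu>]
  have [simp]: "pure x y \<in> carrier (tensor_product S M N)" if "x \<in> carrier M" "y \<in> carrier N" for x y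
    using that by (simp add: tensor_class_in_carrier)
  show ?thesis
  proof
    show "\<nu> (pure x y) \<in> carrier R" if "x \<in> carrier M" "y \<in> carrier N" for x y
      using \<nu>s(4)[of "pure x y"] that by simp
  qed (simp_all add: pure_add_left pure_add_right pure_balanced \<nu>s(5-)
      flip: smult_pure rsmult_pure)
qed

text \<open>
  Each argument of a pairing becomes a functional on the other side. Balancedness says exactly
  that currying is \<open>S\<close>-linear for the action on functionals through their argument.
\<close>

context balanced_pairing
begin

lemma curry_left_dual: "(\<lambda>y. \<lambda>x\<in>carrier M. \<beta> x y) \<in> bimodule_hom S R N (left_dual R M)"
  by (rule bimodule_homI)
    (auto simp: mem_left_dual_iff closed add_left add_right balanced smult_left smult_right
      L.add.m_closed L.smult_closed L.rsmult_closed intro!: restrict_ext)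

lemma curry_right_dual: "(\<lambda>x. \<lambda>y\<in>carrier N. \<beta> x y) \<in> bimodule_hom R S M (right_dual R N)"
  by (rule bimodule_homI)
    (auto simp: mem_right_dual_iff closed add_left add_right balanced smult_left smult_right
      N.add.m_closed N.smult_closed N.rsmult_closed intro!: restrict_ext)

end

section \<open>Separably equivalent rings\<close>

theorem proposition5p3:
  fixes A :: "('a, 'r) ring_scheme" and B :: "('b, 's) ring_scheme"
  assumes "ring A" and "ring B"
    and "separably_equivalent TYPE('p) TYPE('q) A B"
  shows "\<exists>V :: ('a, 'b, 'p) bimodule. biseparable A B V"
proof -
  from assms(3) obtain P :: "('a, 'b, 'p) bimodule" and Q :: "('b, 'a, 'q) bimodule" and \<nu> \<mu>
    where P: "fin_proj_bimodule A B P" and Q: "fin_proj_bimodule B A Q"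
      and \<nu>: "split_bimodule_epi A A (tensor_product B P Q) (regular_bimodule A) \<nu>"
      and \<mu>: "split_bimodule_epi B B (tensor_product A Q P) (regular_bimodule B) \<mu>"
    by (auto simp: separably_equivalent_def)
  interpret P: bimodule A B P using P by (simp add: fin_proj_bimodule_def)
  interpret Q: bimodule B A Q using Q by (simp add: fin_proj_bimodule_def)
  have PQ: "tensor_pair A B A P Q" and QP: "tensor_pair B A B Q P"
    by (simp_all add: tensor_pair_def P.bimodule_axioms Q.bimodule_axioms)
  have "split_bimodule_epi A A (tensor_product B P (left_dual A P)) (regular_bimodule A)
      (tensor_lift A (\<lambda>v f. f v))"
  proof (rule balanced_pairing.split_epi_tensor_lift[OF P.left_dual_evaluation PQ bimodule_hom_ident _ \<nu>])
    show "(\<lambda>y. \<lambda>x\<in>carrier P. \<nu> (tensor_class B P Q (frag_of (x, y))))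
        \<in> bimodule_hom B A Q (left_dual A P)"
      by (rule balanced_pairing.curry_left_dual[OF balanced_pairing_of_hom[OF PQ]])
        (use \<nu> in \<open>simp add: split_bimodule_epi_def\<close>)
  qed simp
  moreover have "split_bimodule_epi B B (tensor_product A (right_dual B P) P) (regular_bimodule B)
      (tensor_lift B (\<lambda>g v. g v))"
  proof (rule balanced_pairing.split_epi_tensor_lift[OF P.right_dual_evaluation QP _ bimodule_hom_ident \<mu>])
    show "(\<lambda>x. \<lambda>y\<in>carrier P. \<mu> (tensor_class A Q P (frag_of (x, y))))
        \<in> bimodule_hom B A Q (right_dual B P)"
      by (rule balanced_pairing.curry_right_dual[OF balanced_pairing_of_hom[OF QP]])
        (use \<mu> in \<open>simp add: split_bimodule_epi_def\<close>)
  qed simp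
  ultimately have "biseparable A B P"
    using P by (simp add: biseparable_def)
  then show ?thesis ..
qed

end
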